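(* With $\Lambda(\mathcal{S}_i)$ denoting the spectrum of the separated property $\mathcal{S}_i$ (a set of pairs $(\omega,p)$), one has: (1) $\Lambda(\mathcal{S}_1)=((\mathrm{T}1.1\sqcup\mathrm{T}2.1)\times\mathbb{N})\sqcup((\mathrm{T}1.2\sqcup\mathrm{T}2.2)\times\Gamma_a)$; (2) $\Lambda(\mathcal{S}_2)=((\mathrm{T}1.1\sqcup\mathrm{T}2.1)\times\mathbb{N})\sqcup((\mathrm{T}1.2\sqcup\mathrm{T}2.2)\times\Gamma_{aa})$; (3) $\Lambda(\mathcal{S}_3)=(\mathrm{T}1.1\sqcup\mathrm{T}2.1)\times\mathbb{N}$; (4) the set of factors $\omega$ with $\omega\in\mathcal{S}_\infty$ is $\mathrm{T}1.1\sqcup\mathrm{T}2.1$. Here $\sqcup$ denotes disjoint union.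
   Context: Words are over $\{a,b\}$; $\varepsilon$ is the empty word, $|\omega|$ the length. Let $\sigma(a)=ab$, $\sigma(b)=a$, $F_k=\sigma^k(a)$ for $k\ge0$, and $F_\infty=\lim_{k\to\infty}F_k$ (Fibonacci sequence), with $F_\infty[p]$ its $p$-th letter, $p\in\mathbb{N}=\{1,2,\dots\}$. Let $f_{-1}=f_0=1$, $f_{k+1}=f_k+f_{k-1}$, so $|F_k|=f_k$. For $k\ge0$ let $\alpha$ be the last letter of $F_k$ and $\beta$ the other letter; the singular words are $s_{-1}=a$ and $s_k=\beta F_k\alpha^{-1}$ for $k\ge0$ (delete the last letter of $F_k$ and prepend $\beta$). Throughout, $\omega$ ranges over the factors of $F_\infty$ with $\omega\notin\{\varepsilon,ab,ba,aba\}$; for such $\omega$ the singular kernel $sk(\omega)$, the longest singular word that is a factor of $\omega$, is well defined. Types: for such $\omega$ let $k\ge0$ be the unique integer with $f_k\le|\omega|<f_{k+1}$. Then $\omega\in\mathrm{T}1.j$ iff $|\omega|=f_k$ and $sk(\omega)=s_{k-j+1}$, and $\omega\in\mathrm{T}2.j$ iff $f_k<|\omega|<f_{k+1}$ and $sk(\omega)=s_{k-j+1}$, for $j=1,2,3$ (for $j=3$ only $k\ge1$ is considered). $\omega_p$ denotes the $p$-th occurrence of $\omega$ in $F_\infty$ ($p\ge1$). Write $\omega_p\in\mathcal{S}_i$ ($i\ge1$) if for each $0\le t<i$ the consecutive occurrences $\omega_{p+t}$ and $\omega_{p+t+1}$ are separated by a nonempty word, i.e. $\omega_{p+t+1}$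 begins strictly later than the position immediately following the end of $\omega_{p+t}$. Write $\omega\in\mathcal{S}_i$ if $\omega_p\in\mathcal{S}_i$ for some $p$, and $\omega\in\mathcal{S}_\infty$ if $\omega\in\mathcal{S}_i$ for all $i\ge1$. The spectrum is $\Lambda(\mathcal{S}_i)=\{(\omega,p): p\in\mathbb{N},\ \omega_p\in\mathcal{S}_i\}$. $\Gamma_a=\{p: F_\infty[p]=a\}$, $\Gamma_{aa}=\{p:F_\infty[p]=F_\infty[p+1]=a\}$. *)

theory Defs
  imports "HOL-Library.Sublist" "HOL-Library.Infinite_Set" "HOL-Number_Theory.Fib"
begin

section \<open>The Fibonacci sequence\<close>

datatype letter = La | Lb

type_synonym word = "letter list"

primrec other :: "letter \<Rightarrow> letter" where
  "other La = Lb"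
| "other Lb = La"

primrec subst_letter :: "letter \<Rightarrow> word" where
  "subst_letter La = [La, Lb]"
| "subst_letter Lb = [La]"

definition subst :: "word \<Rightarrow> word" where
  "subst w = concat (map subst_letter w)"

definition fib_word :: "nat \<Rightarrow> word" where
  "fib_word k = (subst ^^ k) [La]"

text \<open>The convention is \<open>f\<^sub>-\<^sub>1 = f\<^sub>0 = 1\<close>, so the index is shifted by two with respect to
  \<^const>\<open>fib\<close>; only indices \<open>k \<ge> 0\<close> are needed below.\<close>

definition fib_len :: "nat \<Rightarrow> nat" where
  "fib_len k = fib (k + 2)"

text \<open>The limit word: its \<open>p\<close>-th letter is the eventual value of the \<open>p\<close>-th letter of
  \<open>F\<^sub>k\<close>. Positions are counted from \<open>1\<close>; the value at \<open>p = 0\<close> has no meaning.\<close>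

definition fib_inf :: "nat \<Rightarrow> letter" where
  "fib_inf p = (THE c. \<forall>\<^sub>F k in sequentially. p \<le> length (fib_word k) \<and> fib_word k ! (p - 1) = c)"

lemma subst_append: "subst (u @ v) = subst u @ subst v"
  by (simp add: subst_def)

lemma fib_word_0: "fib_word 0 = [La]"
  by (simp add: fib_word_def)

lemma fib_word_1: "fib_word (Suc 0) = [La, Lb]"
  by (simp add: fib_word_def subst_def)

lemma fib_word_Suc: "fib_word (Suc k) = subst (fib_word k)"
  by (simp add: fib_word_def)

lemma fib_word_rec: "fib_word (Suc (Suc k)) = fib_word (Suc k) @ fib_word k"
proof (induction k)
  case 0
  show ?case by (simp add: fib_word_def subst_def)
next
  case (Suc k)
  then show ?case by (metis fib_word_Suc subst_append)
qed

lemma length_fib_word: "length (fib_word k) = fib_len k"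
proof (induction k rule: fib.induct)
  case 1
  show ?case by (simp add: fib_word_0 fib_len_def numeral_2_eq_2)
next
  case 2
  show ?case by (simp add: fib_word_1 fib_len_def numeral_3_eq_3 numeral_2_eq_2)
next
  case (3 n)
  then show ?case by (simp add: fib_word_rec fib_len_def)
qed

lemma fib_word_nonempty: "fib_word k \<noteq> []"
  using length_fib_word[of k] fib_neq_0_nat[of "k + 2"] by (auto simp: fib_len_def)

lemma prefix_fib_word_Suc: "prefix (fib_word k) (fib_word (Suc k))"
  by (cases k) (simp_all add: fib_word_0 fib_word_1 fib_word_rec)

lemma prefix_fib_word: "k \<le> l \<Longrightarrow> prefix (fib_word k) (fib_word l)"
  by (induction l rule: dec_induct) (simp, metis prefix_order.trans prefix_fib_word_Suc)

lemma length_fib_word_gt: "k < length (fib_word k)"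
proof (induction k)
  case 0
  show ?case by (simp add: fib_word_0)
next
  case (Suc k)
  show ?case
  proof (cases k)
    case 0
    then show ?thesis by (simp add: fib_word_1)
  next
    case (Suc m)
    have "fib_word m \<noteq> []" by (rule fib_word_nonempty)
    then have "0 < length (fib_word m)" by simp
    moreover have "Suc m < length (fib_word (Suc m))" using \<open>k < length (fib_word k)\<close> Suc by simp
    moreover have "length (fib_word (Suc k)) = length (fib_word (Suc m)) + length (fib_word m)"
      by (simp only: Suc fib_word_rec length_append)
    ultimately show ?thesis using Suc by linarith
  qed
qed

lemma fib_inf_eq:
  assumes "p \<ge> 1" and "p \<le> length (fib_word k)"
  shows "fib_inf p = fib_word k ! (p - 1)"
  unfolding fib_inf_def
proof (rule the_equality)
  have *: "p \<le> length (fib_word l) \<and> fib_word l ! (p - 1) = fib_word k ! (p - 1)" if kl: "k \<le> l" for l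
  proof -
    obtain zs where "fib_word l = fib_word k @ zs"
      using prefix_fib_word[OF kl] by (rule prefixE)
    then show ?thesis using assms by (auto simp: nth_append)
  qed
  show ev: "\<forall>\<^sub>F l in sequentially. p \<le> length (fib_word l) \<and>
              fib_word l ! (p - 1) = fib_word k ! (p - 1)"
    by (rule eventually_sequentiallyI[of k], rule *)
  fix c
  assume "\<forall>\<^sub>F l in sequentially. p \<le> length (fib_word l) \<and> fib_word l ! (p - 1) = c"
  with ev have "\<forall>\<^sub>F l in sequentially. c = fib_word k ! (p - 1)"
    by eventually_elim auto
  then show "c = fib_word k ! (p - 1)" by simp
qed

section \<open>Factors, singular words and types\<close>

definition occ :: "word \<Rightarrow> nat set" where
  "occ w = {i. i \<ge> 1 \<and> (\<forall>j < length w. fib_inf (i + j) = w ! j)}"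

text \<open>The standing range of \<open>\<omega>\<close>.\<close>

definition factors :: "word set" where
  "factors = {w. occ w \<noteq> {}} - {[], [La, Lb], [Lb, La], [La, Lb, La]}"

text \<open>Indices \<open>k \<ge> -1\<close> only.\<close>

definition sing :: "int \<Rightarrow> word" where
  "sing k = (if k = -1 then [La]
             else other (last (fib_word (nat k))) # butlast (fib_word (nat k)))"

definition sing_factors :: "word \<Rightarrow> word set" where
  "sing_factors w = {sing k | k. k \<ge> -1 \<and> sublist (sing k) w}"

text \<open>\<open>sing (-1)\<close> and \<open>sing 0\<close> both have length one, so a word containing both letters but no longer
  singular word has no unique longest singular factor; the factors of this kind
  (\<open>ab\<close>, \<open>ba\<close>, \<open>aba\<close>) are excluded from \<^const>\<open>factors\<close>.\<close>

definition sk :: "word \<Rightarrow> word" where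
  "sk w = (THE v. v \<in> sing_factors w \<and> (\<forall>u \<in> sing_factors w. length u \<le> length v))"

text \<open>Since \<^const>\<open>fib_len\<close> is strictly increasing, the \<open>k\<close> in the two definitions below is the
  unique one with \<open>fib_len k \<le> length w < fib_len (k + 1)\<close>.\<close>

definition T1 :: "nat \<Rightarrow> word set" where
  "T1 j = {w \<in> factors. j \<in> {1, 2, 3} \<and>
     (\<exists>k. (j = 3 \<longrightarrow> k \<ge> 1) \<and> length w = fib_len k \<and>
          sk w = sing (int k - int j + 1))}"

definition T2 :: "nat \<Rightarrow> word set" where
  "T2 j = {w \<in> factors. j \<in> {1, 2, 3} \<and>
     (\<exists>k. (j = 3 \<longrightarrow> k \<ge> 1) \<and> fib_len k < length w \<and> length w < fib_len (k + 1) \<and>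
          sk w = sing (int k - int j + 1))}"

section \<open>The separated property\<close>

text \<open>Starting position of the \<open>p\<close>-th occurrence, \<open>p \<ge> 1\<close>; \<^const>\<open>enumerate\<close> lists the (infinite)
  set of occurrences of a factor in increasing order, counting from \<open>0\<close>.\<close>

definition occ_pos :: "word \<Rightarrow> nat \<Rightarrow> nat" where
  "occ_pos w p = enumerate (occ w) (p - 1)"

definition sep :: "nat \<Rightarrow> word \<Rightarrow> nat \<Rightarrow> bool" where
  "sep i w p \<longleftrightarrow> (\<forall>t < i. occ_pos w (p + t) + length w < occ_pos w (p + t + 1))"

definition sep_word :: "nat \<Rightarrow> word \<Rightarrow> bool" where
  "sep_word i w \<longleftrightarrow> (\<exists>p \<ge> 1. sep i w p)"

definition sep_inf :: "word \<Rightarrow> bool" where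
  "sep_inf w \<longleftrightarrow> (\<forall>i \<ge> 1. sep_word i w)"

definition spectrum :: "nat \<Rightarrow> (word \<times> nat) set" where
  "spectrum i = {(w, p). w \<in> factors \<and> p \<ge> 1 \<and> sep i w p}"

definition Gamma_a :: "nat set" where
  "Gamma_a = {p. p \<ge> 1 \<and> fib_inf p = La}"

definition Gamma_aa :: "nat set" where
  "Gamma_aa = {p. p \<ge> 1 \<and> fib_inf p = La \<and> fib_inf (p + 1) = La}"

end

theory Submission
  imports Defs
begin


text \<open>
  The separation of two consecutive occurrences is a comparison of \<open>|\<omega>|\<close> with the distance of
  their starting positions, so everything follows from knowing these distances. They are
  governed by one rule: if \<open>sk(\<omega>) = s\<^sub>m\<close>, then the distance from the \<open>p\<close>-th to the next occurrence
  is \<open>f\<^sub>m\<^sub>+\<^sub>2\<close> when \<open>F\<^sub>\<infinity>[p] = a\<close> and \<open>f\<^sub>m\<^sub>+\<^sub>1\<close> when \<open>F\<^sub>\<infinity>[p] = b\<close>. With \<open>f\<^sub>k \<le> |\<omega>| < f\<^sub>k\<^sub>+\<^sub>1\<close> and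
  \<open>m = k - j + 1\<close> the three cases are immediate: for \<open>j = 1\<close> both distances exceed \<open>|\<omega>|\<close>; for
  \<open>j = 2\<close> only the longer one does, so that \<open>\<S>\<^sub>i\<close> at \<open>p\<close> says that \<open>F\<^sub>\<infinity>\<close> carries \<open>i\<close> consecutive
  letters \<open>a\<close> from position \<open>p\<close> on, which is impossible for \<open>i = 3\<close>; for \<open>j \<ge> 3\<close> neither does.

  The rule is proved by undoing the substitution. A factor \<open>\<omega>\<close> that starts with \<open>b\<close> is always
  preceded by \<open>a\<close>, and one that ends with \<open>b\<close> is always followed by \<open>a\<close>; adding these letters
  changes the occurrences at most by a shift. A padded factor other than \<open>a\<close> has the form
  \<open>\<sigma>(v)a\<close> for a factor \<open>v\<close>, and since every \<open>a\<close> in \<open>F\<^sub>\<infinity> = \<sigma>(F\<^sub>\<infinity>)\<close> is the first letter of a block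
  \<open>\<sigma>(c)\<close>, the occurrences of \<open>\<sigma>(v)a\<close> correspond exactly to those of \<open>v\<close>, in the same order. Two
  occurrences of \<open>v\<close> at distance \<open>d\<close> with \<open>e\<close> letters \<open>a\<close> between their starts become two at distance
  \<open>d + e\<close> with \<open>d\<close> letters \<open>a\<close> between. So each step moves the pair \<open>(d, e)\<close> one place along
  the Fibonacci numbers, and the process ends at the word \<open>a\<close>, whose \<open>p\<close>-th occurrence starts the
  block of the \<open>p\<close>-th letter (\<open>return_times_La\<close>, \<open>return_times_step\<close>,
  \<open>segment_kernel_index\<close>).

  The number \<open>n\<close> of steps identifies the kernel. The padded singular words satisfy the same
  recursion (\<open>pad_singular\<close>), hence \<open>s\<^sub>n\<^sub>-\<^sub>1\<close> survives every step as a factor of the word. A longer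
  singular word cannot be a factor, because its occurrences are too far apart
  (\<open>singular_sublist_index\<close>). Thus \<open>sk(\<omega>) = s\<^sub>n\<^sub>-\<^sub>1\<close> (\<open>sk_eq_singular\<close>).
\<close>

section \<open>The block structure of the Fibonacci sequence\<close>

text \<open>Positions are counted from \<open>0\<close> here, which makes prefix lengths and positions agree.\<close>

definition fib_letter :: "nat \<Rightarrow> letter" where
  "fib_letter n = fib_inf (Suc n)"

definition segment :: "nat \<Rightarrow> nat \<Rightarrow> word" where
  "segment i j = map fib_letter [i..<j]"

primrec count_La :: "nat \<Rightarrow> nat" where
  "count_La 0 = 0"
| "count_La (Suc n) = count_La n + (if fib_letter n = La then 1 else 0)"

text \<open>\<open>F\<^sub>\<infinity>\<close> is the concatenation of the blocks \<open>\<sigma>(c)\<close> for its letters \<open>c\<close>. Since \<open>\<sigma>(a)\<close> has two letters and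
  \<open>\<sigma>(b)\<close> one, the block of the \<open>n\<close>-th letter starts at this position.\<close>

definition block_start :: "nat \<Rightarrow> nat" where
  "block_start n = n + count_La n"

lemma block_start_0 [simp]: "block_start 0 = 0"
  by (simp add: block_start_def)

lemma block_start_Suc:
  "block_start (Suc n) = block_start n + (if fib_letter n = La then 2 else 1)"
  by (simp add: block_start_def)

lemma strict_mono_block_start: "strict_mono block_start"
  by (simp add: strict_mono_Suc_iff block_start_Suc)

lemma fib_letter_nth: "n < length (fib_word k) \<Longrightarrow> fib_letter n = fib_word k ! n"
  by (simp add: fib_letter_def fib_inf_eq[of "Suc n" k])

lemma segment_eq_take: "n \<le> length (fib_word k) \<Longrightarrow> segment 0 n = take n (fib_word k)"
  by (rule nth_equalityI) (auto simp: segment_def fib_letter_nth[of _ k])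

lemma segment_Suc: "i \<le> j \<Longrightarrow> segment i (Suc j) = segment i j @ [fib_letter j]"
  by (simp add: segment_def)

lemma subst_Nil [simp]: "subst [] = []"
  and subst_Cons: "subst (c # w) = subst_letter c @ subst w"
  by (simp_all add: subst_def)

lemma length_subst_segment: "length (subst (segment 0 n)) = block_start n"
proof (induction n)
  case 0
  show ?case by (simp add: segment_def)
next
  case (Suc n)
  then show ?case
    by (cases "fib_letter n")
       (simp_all add: segment_Suc subst_append subst_Cons block_start_Suc)
qed

lemma subst_segment_0: "subst (segment 0 n) = segment 0 (block_start n)"
proof -
  have n: "n \<le> length (fib_word n)"
    using length_fib_word_gt[of n] by simp
  have split: "subst (fib_word n) = subst (take n (fib_word n)) @ subst (drop n (fib_word n))"
    by (metis append_take_drop_id subst_append)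
  have w: "fib_word (Suc n) = subst (segment 0 n) @ subst (drop n (fib_word n))"
    by (simp add: fib_word_Suc split segment_eq_take[OF n])
  then have le: "block_start n \<le> length (fib_word (Suc n))"
    by (simp add: length_subst_segment)
  have "segment 0 (block_start n) = take (block_start n) (fib_word (Suc n))"
    by (rule segment_eq_take[OF le])
  also have "\<dots> = subst (segment 0 n)"
    by (simp add: w length_subst_segment)
  finally show ?thesis by simp
qed

lemma segment_append: "i \<le> j \<Longrightarrow> j \<le> k \<Longrightarrow> segment i j @ segment j k = segment i k"
  by (simp add: segment_def flip: map_append upt_add_eq_append)
    (metis le_add_diff_inverse upt_add_eq_append map_append)

lemma subst_segment:
  assumes "i \<le> j"
  shows "subst (segment i j) = segment (block_start i) (block_start j)"
proof -
  have le: "block_start i \<le> block_start j"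
    using assms strict_mono_block_start by (simp add: strict_mono_less_eq)
  have "subst (segment 0 i) @ subst (segment i j) = subst (segment 0 j)"
    by (simp add: segment_append assms flip: subst_append)
  then have "segment 0 (block_start i) @ subst (segment i j)
      = segment 0 (block_start i) @ segment (block_start i) (block_start j)"
    by (simp add: subst_segment_0 segment_append le)
  then show ?thesis by simp
qed

lemma segment_Suc_eq: "segment n (Suc n) = [fib_letter n]"
  and segment_Suc2_eq: "segment n (Suc (Suc n)) = [fib_letter n, fib_letter (Suc n)]"
  by (simp_all add: segment_def)

lemma segment_block:
  "segment (block_start n) (block_start (Suc n)) = subst_letter (fib_letter n)"
  using subst_segment[of n "Suc n"] by (simp add: segment_def subst_Cons)

lemma fib_letter_block_start [simp]: "fib_letter (block_start n) = La"
  using segment_block[of n]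
  by (cases "fib_letter n") (simp_all add: segment_Suc_eq segment_Suc2_eq block_start_Suc)

lemma fib_letter_Suc_block_start:
  "fib_letter (Suc (block_start n)) = Lb \<longleftrightarrow> fib_letter n = La"
proof (cases "fib_letter n")
  case La
  then show ?thesis
    using segment_block[of n] by (simp add: segment_Suc2_eq block_start_Suc)
next
  case Lb
  then have "Suc (block_start n) = block_start (Suc n)"
    by (simp add: block_start_Suc)
  then show ?thesis
    using Lb fib_letter_block_start[of "Suc n"] by simp
qed

text \<open>A position is either the first of its block or the second one of a block \<open>ab\<close>; all facts on
  neighbouring letters below are read off from this.\<close>

lemma block_cases:
  obtains (start) n where "m = block_start n"
  | (inner) n where "fib_letter n = La" "m = Suc (block_start n)"
proof -
  have "(\<exists>n. m = block_start n) \<or> (\<exists>n. fib_letter n = La \<and> m = Suc (block_start n))"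
  proof (induction m)
    case 0
    show ?case by (metis block_start_0)
  next
    case (Suc m)
    then show ?case
    proof
      assume "\<exists>n. m = block_start n"
      then obtain n where n: "m = block_start n" ..
      show ?thesis
      proof (cases "fib_letter n")
        case La
        then show ?thesis using n by blast
      next
        case Lb
        then have "Suc m = block_start (Suc n)"
          by (simp add: n block_start_Suc)
        then show ?thesis by blast
      qed
    next
      assume "\<exists>n. fib_letter n = La \<and> m = Suc (block_start n)"
      then obtain n where "fib_letter n = La" "m = Suc (block_start n)" by blast
      then have "Suc m = block_start (Suc n)"
        by (simp add: block_start_Suc)
      then show ?thesis by blast
    qed
  qed
  then show thesis using that by blast
qed

lemma letter_La_iff: "fib_letter m = La \<longleftrightarrow> m \<in> range block_start"
proof (cases m rule: block_cases)
  case (start n)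
  then show ?thesis by simp
next
  case (inner n)
  then have "fib_letter m = Lb"
    by (simp add: fib_letter_Suc_block_start)
  then show ?thesis by auto
qed

lemma letter_LbE:
  assumes "fib_letter m = Lb"
  obtains n where "fib_letter n = La" "m = Suc (block_start n)" "Suc m = block_start (Suc n)"
  using assms
proof (cases m rule: block_cases)
  case (start n)
  then show ?thesis using assms by simp
next
  case (inner n)
  then show ?thesis using that by (simp add: block_start_Suc)
qed

lemma La_after_Lb: "fib_letter m = Lb \<Longrightarrow> fib_letter (Suc m) = La"
  by (metis fib_letter_block_start letter_LbE)

lemma La_before_Lb: "fib_letter m = Lb \<Longrightarrow> m > 0 \<and> fib_letter (m - 1) = La"
  by (metis fib_letter_block_start letter_LbE diff_Suc_1 zero_less_Suc)

text \<open>The first two letters of \<open>aaa\<close> would be blocks \<open>\<sigma>(b)\<close> of consecutive letters, but \<open>bb\<close> does not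
  occur.\<close>

lemma no_three_La:
  "\<not> (fib_letter m = La \<and> fib_letter (m + 1) = La \<and> fib_letter (m + 2) = La)"
proof
  assume *: "fib_letter m = La \<and> fib_letter (m + 1) = La \<and> fib_letter (m + 2) = La"
  then obtain n where n: "m = block_start n" by (auto simp: letter_La_iff)
  with * have b: "fib_letter n = Lb"
    using fib_letter_Suc_block_start[of n] by (cases "fib_letter n") auto
  then have n': "m + 1 = block_start (Suc n)" by (simp add: n block_start_Suc)
  with * have "fib_letter (Suc n) = Lb"
    using fib_letter_Suc_block_start[of "Suc n"] by (cases "fib_letter (Suc n)") auto
  then show False using La_after_Lb[OF b] by simp
qed

text \<open>Every block contains exactly one \<open>a\<close>.\<close>

lemma count_La_block_start: "count_La (block_start n) = n"
proof (induction n)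
  case 0
  show ?case by simp
next
  case (Suc n)
  then show ?case
    using fib_letter_Suc_block_start[of n] by (cases "fib_letter n") (simp_all add: block_start_Suc)
qed

section \<open>Occurrences and the substitution\<close>

definition occs :: "word \<Rightarrow> nat set" where
  "occs w = {n. Suc n \<in> occ w}"

lemma occ_eq: "occ w = Suc ` occs w"
proof -
  have "i \<in> Suc ` {n. Suc n \<in> occ w}" if "i \<in> occ w" for i
    using that by (cases i) (auto simp: occ_def)
  then show ?thesis by (auto simp: occs_def)
qed

lemma occs_iff_nth: "n \<in> occs w \<longleftrightarrow> (\<forall>j < length w. fib_letter (n + j) = w ! j)"
  by (simp add: occs_def occ_def fib_letter_def)

lemma occs_iff_segment: "n \<in> occs w \<longleftrightarrow> segment n (n + length w) = w"
proof -
  have "length (segment n (n + length w)) = length w"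
    and "\<forall>j < length w. segment n (n + length w) ! j = fib_letter (n + j)"
    by (simp_all add: segment_def)
  then show ?thesis by (metis occs_iff_nth nth_equalityI)
qed

lemma occs_Nil [simp]: "n \<in> occs []"
  by (simp add: occs_iff_nth)

lemma occs_append: "n \<in> occs (u @ v) \<longleftrightarrow> n \<in> occs u \<and> n + length u \<in> occs v"
proof -
  have "segment n (n + length u + length v)
      = segment n (n + length u) @ segment (n + length u) (n + length u + length v)"
    by (simp add: segment_append)
  moreover have "length (segment n (n + length u)) = length u" by (simp add: segment_def)
  ultimately show ?thesis by (simp add: occs_iff_segment add.assoc)
qed

lemma occs_Cons: "n \<in> occs (c # w) \<longleftrightarrow> fib_letter n = c \<and> Suc n \<in> occs w"
proof -
  have "n \<in> occs [c] \<longleftrightarrow> fib_letter n = c"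
    by (simp add: occs_iff_nth)
  then show ?thesis using occs_append[of n "[c]" w] by simp
qed

lemma occs_sublist:
  assumes "sublist u w"
  obtains d where "\<And>n. n \<in> occs w \<Longrightarrow> n + d \<in> occs u"
proof -
  from assms obtain p q where "w = p @ u @ q"
    by (auto simp: sublist_def)
  then have "n + length p \<in> occs u" if "n \<in> occs w" for n
    using that by (simp add: occs_append)
  then show thesis by (rule that)
qed

lemma subst_snoc_La_starts_La:
  assumes "m \<in> occs (subst v @ [La])"
  shows "fib_letter m = La"
proof (cases v)
  case Nil
  then show ?thesis using assms by (simp add: occs_Cons)
next
  case (Cons c u)
  then show ?thesis using assms by (cases c) (simp_all add: subst_Cons occs_Cons)
qed

text \<open>An occurrence of \<open>\<sigma>(v)a\<close> that starts at a block boundary is cut into blocks in only one way: the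
  letter after an \<open>a\<close> tells \<open>ab\<close> and \<open>a\<close> apart. The final \<open>a\<close> is needed to make this decision for the last
  letter of \<open>v\<close>.\<close>

lemma block_start_occs_subst:
  "block_start n \<in> occs (subst v @ [La]) \<longleftrightarrow> n \<in> occs v"
proof (induction v arbitrary: n)
  case Nil
  show ?case by (simp add: occs_Cons)
next
  case (Cons c v)
  show ?case
  proof (cases "fib_letter n")
    case La
    then show ?thesis
      using Cons.IH[of "Suc n"] fib_letter_Suc_block_start[of n]
        subst_snoc_La_starts_La[of "Suc (block_start n)" v]
      by (cases c) (auto simp: subst_Cons occs_Cons block_start_Suc)
  next
    case Lb
    then show ?thesis
      using Cons.IH[of "Suc n"] fib_letter_Suc_block_start[of n]
      by (cases c) (auto simp: subst_Cons occs_Cons block_start_Suc)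
  qed
qed

lemma occs_subst: "occs (subst v @ [La]) = block_start ` occs v"
proof (intro equalityI subsetI)
  fix m
  assume m: "m \<in> occs (subst v @ [La])"
  then have "fib_letter m = La" by (rule subst_snoc_La_starts_La)
  then obtain n where "m = block_start n" by (auto simp: letter_La_iff)
  then show "m \<in> block_start ` occs v" using m by (simp add: block_start_occs_subst)
next
  fix m
  assume "m \<in> block_start ` occs v"
  then show "m \<in> occs (subst v @ [La])" by (auto simp: block_start_occs_subst)
qed

text \<open>Adding the letters that are forced at both ends. The padded word starts and ends with \<open>a\<close>, that is,
  at the beginning of a block.\<close>

definition pad :: "word \<Rightarrow> word" where
  "pad w = (if hd w = Lb then [La] else []) @ w @ (if last w = Lb then [La] else [])"

lemma occs_snoc_La:
  assumes "w \<noteq> []" "last w = Lb"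
  shows "occs (w @ [La]) = occs w"
proof -
  from assms obtain u where w: "w = u @ [Lb]" by (metis append_butlast_last_id)
  have "n + length w \<in> occs [La]" if "n \<in> occs w" for n
  proof -
    have "fib_letter (n + length u) = Lb"
      using that by (simp add: w occs_append occs_Cons)
    then have "fib_letter (Suc (n + length u)) = La" by (rule La_after_Lb)
    then show ?thesis by (simp add: w occs_Cons)
  qed
  then show ?thesis by (auto simp: occs_append)
qed

lemma occs_Cons_La:
  assumes "w \<noteq> []" "hd w = Lb"
  shows "occs w = Suc ` occs (La # w)"
proof -
  have "n \<in> Suc ` occs (La # w)" if n: "n \<in> occs w" for n
  proof -
    have "fib_letter n = Lb" using n assms by (cases w) (auto simp: occs_Cons)
    from La_before_Lb[OF this] have "n - 1 \<in> occs (La # w)" "n = Suc (n - 1)"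
      using n by (auto simp: occs_Cons)
    then show ?thesis by blast
  qed
  then show ?thesis by (auto simp: occs_Cons)
qed

lemma occs_pad:
  assumes "w \<noteq> []"
  shows "occs w = (if hd w = Lb then Suc else id) ` occs (pad w)"
proof -
  have 1: "occs w = (if hd w = Lb then Suc else id) ` occs ((if hd w = Lb then [La] else []) @ w)"
    using assms by (auto simp: occs_Cons_La)
  have 2: "occs (pad w) = occs ((if hd w = Lb then [La] else []) @ w)"
    using assms occs_snoc_La[of "(if hd w = Lb then [La] else []) @ w"] by (auto simp: pad_def)
  show ?thesis by (subst 1) (simp add: 2)
qed

section \<open>Distances between occurrences\<close>

text \<open>\<open>x\<close> lists the occurrences in increasing order. The number of letters \<open>a\<close> passed between two
  occurrences is recorded besides their distance, because both are needed to compute the distance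
  after a substitution. The index \<open>n\<close> belongs to the kernel \<open>s\<^sub>n\<^sub>-\<^sub>1\<close>, and \<open>f\<^sub>k\<close> is \<open>fib (k + 2)\<close>.\<close>

definition return_times :: "nat \<Rightarrow> word \<Rightarrow> (nat \<Rightarrow> nat) \<Rightarrow> bool" where
  "return_times n w x \<longleftrightarrow> occs w = range x \<and>
     (\<forall>p. x (Suc p) = x p + (if fib_letter p = La then fib (n + 3) else fib (n + 2)) \<and>
          count_La (x (Suc p)) = count_La (x p) +
            (if fib_letter p = La then fib (n + 2) else fib (n + 1)))"

lemma return_times_La: "return_times 0 [La] block_start"
proof -
  have "occs [La] = range block_start"
    by (auto simp: occs_Cons letter_La_iff)
  moreover have "fib 3 = 2"
    by (simp add: numeral_3_eq_3)
  ultimately show ?thesis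
    by (simp add: return_times_def count_La_block_start del: count_La.simps)
      (simp add: block_start_Suc)
qed

text \<open>A word with \<open>e\<close> letters \<open>a\<close> and length \<open>d\<close> has an image with \<open>d\<close> letters \<open>a\<close> and length \<open>d + e\<close>.
  If the padding adds a letter on the left, all positions are shifted by one, across an \<open>a\<close> each
  time, so the differences do not change.\<close>

lemma return_times_step:
  assumes x: "return_times n v x" and w: "w \<noteq> []" and pad: "pad w = subst v @ [La]"
  shows "\<exists>y. return_times (Suc n) w y"
proof -
  define s where "s = (if hd w = Lb then 1 else (0::nat))"
  define y where "y p = block_start (x p) + s" for p
  have y_shift: "y = (if hd w = Lb then Suc else id) \<circ> block_start \<circ> x"
    by (rule ext) (simp add: y_def s_def)
  have "occs w = range y"
    using x by (simp add: return_times_def occs_pad[OF w] pad occs_subst y_shift image_comp comp_assoc)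
  moreover have count: "count_La (y p) = x p + s" for p
    by (simp add: y_def s_def count_La_block_start)
  moreover have "count_La (y (Suc p)) = count_La (y p) +
      (if fib_letter p = La then fib (n + 3) else fib (n + 2))" for p
    using x by (simp add: count return_times_def)
  moreover have "y (Suc p) = y p + (if fib_letter p = La then fib (n + 4) else fib (n + 3))" for p
  proof -
    have "x (Suc p) + count_La (x (Suc p)) = x p + count_La (x p)
        + ((if fib_letter p = La then fib (n + 3) else fib (n + 2))
          + (if fib_letter p = La then fib (n + 2) else fib (n + 1)))"
      using x unfolding return_times_def by (metis add.assoc add.left_commute)
    then show ?thesis
      by (simp add: y_def block_start_def numeral_eq_Suc)
  qed
  ultimately show ?thesis
    unfolding return_times_def by (intro exI[of _ y]) (simp add: numeral_eq_Suc)
qed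

section \<open>Singular words\<close>

text \<open>The shift by one lets the index count the substitutions that lead from \<open>s\<^sub>-\<^sub>1 = a\<close> to the word.\<close>

definition singular :: "nat \<Rightarrow> word" where
  "singular n = sing (int n - 1)"

lemma singular_0: "singular 0 = [La]"
  by (simp add: singular_def sing_def)

lemma singular_Suc: "singular (Suc k) = other (last (fib_word k)) # butlast (fib_word k)"
  by (simp add: singular_def sing_def)

lemma singular_1: "singular (Suc 0) = [Lb]"
  by (simp add: singular_Suc fib_word_0)

lemma fib_less_mono:
  assumes "2 \<le> m" "m < n"
  shows "fib m < fib n"
proof -
  define k where "k = m - 2"
  have k: "m = Suc (Suc k)" using assms by (simp add: k_def)
  have "fib m < fib (Suc m)" by (simp add: k fib_neq_0_nat)
  also have "\<dots> \<le> fib n" using assms by (intro fib_mono) simp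
  finally show ?thesis .
qed

lemma length_singular: "length (singular n) = fib (Suc n)"
proof (cases n)
  case 0
  then show ?thesis by (simp add: singular_0)
next
  case (Suc k)
  have "0 < length (fib_word k)" using fib_word_nonempty by simp
  then have "length (singular n) = length (fib_word k)"
    by (simp add: Suc singular_Suc)
  then show ?thesis by (simp add: Suc length_fib_word fib_len_def numeral_2_eq_2)
qed

lemma last_fib_word: "last (fib_word k) = (if even k then La else Lb)"
  by (induction k rule: fib.induct)
    (simp_all add: fib_word_0 fib_word_1 fib_word_rec fib_word_nonempty)

text \<open>In \<open>s\<^sub>k = \<beta> u\<close> with \<open>F\<^sub>k = u \<alpha>\<close>, the last letter \<open>\<alpha>\<close> is \<open>a\<close> for even \<open>k\<close> and \<open>b\<close> for odd \<open>k\<close>.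
  Applying \<open>\<sigma>\<close> gives \<open>\<sigma>(s\<^sub>k)a = a \<sigma>(u) a = s\<^sub>k\<^sub>+\<^sub>1\<close> in the first case and
  \<open>\<sigma>(s\<^sub>k)a = ab \<sigma>(u) a = a s\<^sub>k\<^sub>+\<^sub>1 a\<close> in the second.\<close>

lemma subst_singular:
  "(if even n then [La] else []) @ singular (Suc n) @ (if even n then [La] else [])
     = subst (singular n) @ [La]"
proof (cases n)
  case 0
  then show ?thesis by (simp add: singular_0 singular_1 subst_Cons)
next
  case (Suc k)
  define u where "u = butlast (fib_word k)"
  have u: "fib_word k = u @ [last (fib_word k)]"
    by (simp add: u_def fib_word_nonempty)
  show ?thesis
  proof (cases "even k")
    case True
    then have "fib_word k = u @ [La]" using u by (simp add: last_fib_word)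
    then show ?thesis using True
      by (simp add: Suc singular_Suc fib_word_Suc subst_append subst_Cons butlast_append)
  next
    case False
    then have "fib_word k = u @ [Lb]" using u by (simp add: last_fib_word)
    then show ?thesis using False
      by (simp add: Suc singular_Suc fib_word_Suc subst_append subst_Cons butlast_append)
  qed
qed

lemma subst_snoc_La_Cons: "\<exists>r. subst v @ [La] = La # r"
proof (cases v)
  case (Cons c u)
  then show ?thesis by (cases c) (simp_all add: subst_Cons)
qed simp

text \<open>The double letters \<open>aa\<close> matter: they show later that \<open>s\<^sub>k\<close> with odd \<open>k \<ge> 1\<close>, as a factor of a padded word,
  does not use the added letters, which stand next to a \<open>b\<close>.\<close>

lemma singular_ends:
  "if even n then (\<exists>u. singular (Suc n) = Lb # u) \<and> (\<exists>v. singular (Suc n) = v @ [Lb])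
   else (\<exists>u. singular (Suc n) = La # La # u) \<and> (\<exists>v. singular (Suc n) = v @ [La, La])"
proof (induction n)
  case 0
  show ?case by (simp add: singular_1)
next
  case (Suc n)
  show ?case
  proof (cases "even n")
    case True
    with Suc obtain u v where uv: "singular (Suc n) = Lb # u" "singular (Suc n) = v @ [Lb]"
      by auto
    have s: "singular (Suc (Suc n)) = subst (singular (Suc n)) @ [La]"
      using subst_singular[of "Suc n"] True by simp
    have "singular (Suc (Suc n)) = La # (subst u @ [La])"
      by (simp add: s uv(1) subst_Cons)
    moreover have "singular (Suc (Suc n)) = subst v @ [La, La]"
      by (simp add: s uv(2) subst_append subst_Cons)
    moreover obtain r where "subst u @ [La] = La # r" using subst_snoc_La_Cons by blast
    ultimately have "\<exists>u. singular (Suc (Suc n)) = La # La # u"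
      and "\<exists>v. singular (Suc (Suc n)) = v @ [La, La]" by metis+
    then show ?thesis using True by simp
  next
    case False
    with Suc obtain u v where uv: "singular (Suc n) = La # La # u" "singular (Suc n) = v @ [La, La]"
      by auto
    have s: "La # singular (Suc (Suc n)) = subst (singular (Suc n))"
      using subst_singular[of "Suc n"] False by simp
    have "singular (Suc (Suc n)) = Lb # La # Lb # subst u"
      using s by (simp add: uv(1) subst_Cons)
    moreover have "singular (Suc (Suc n)) = tl (subst v @ [La, Lb, La]) @ [Lb]"
      using arg_cong[OF s, of tl] by (simp add: uv(2) subst_append subst_Cons tl_append split: list.split)
    ultimately have "\<exists>u. singular (Suc (Suc n)) = Lb # u"
      and "\<exists>v. singular (Suc (Suc n)) = v @ [Lb]" by metis+
    then show ?thesis using False by simp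
  qed
qed

lemma hd_singular: "hd (singular (Suc n)) = (if even n then Lb else La)"
  using singular_ends[of n] by (auto split: if_splits)

lemma last_singular: "last (singular (Suc n)) = (if even n then Lb else La)"
proof (cases "even n")
  case True
  with singular_ends[of n] obtain v where "singular (Suc n) = v @ [Lb]" by auto
  with True show ?thesis by simp
next
  case False
  with singular_ends[of n] obtain v where "singular (Suc n) = v @ [La, La]" by auto
  with False show ?thesis by simp
qed

lemma pad_singular: "pad (singular (Suc n)) = subst (singular n) @ [La]"
  using subst_singular[of n] by (simp add: pad_def hd_singular last_singular split: if_splits)

text \<open>Both ends are treated by one argument, through reversal.\<close>

definition pad_left :: "word \<Rightarrow> word" where
  "pad_left w = (if hd w = Lb then La # w else w)"

lemma pad_eq_pad_left:
  assumes "w \<noteq> []"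
  shows "pad w = rev (pad_left (rev (pad_left w)))"
  using assms by (simp add: pad_def pad_left_def hd_rev)

text \<open>If \<open>pad_left s\<close> starts at the added letter of \<open>pad_left w\<close>, then that letter is not part of \<open>s\<close>: otherwise
  \<open>s\<close> would start with \<open>aa\<close>, whereas \<open>w\<close> starts with \<open>b\<close>.\<close>

lemma sublist_pad_leftD:
  assumes "sublist (pad_left s) (pad_left w)" "w \<noteq> []" and s: "hd s = La \<Longrightarrow> \<exists>u. s = La # La # u"
  shows "sublist s w"
proof -
  have s_le: "sublist s (pad_left s)" by (simp add: pad_left_def sublist_Cons_right)
  show ?thesis
  proof (cases "hd w = Lb")
    case False
    then show ?thesis using assms(1) s_le by (auto simp: pad_left_def intro: sublist_order.order_trans)
  next
    case True
    then consider "prefix (pad_left s) (La # w)" | "sublist (pad_left s) w"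
      using assms(1) by (auto simp: pad_left_def[of w] sublist_Cons_right)
    then show ?thesis
    proof cases
      case 1
      have "prefix s w"
      proof (cases "hd s")
        case La
        then obtain u where "s = La # La # u" using s by blast
        then show ?thesis using 1 True by (cases w) (auto simp: pad_left_def)
      next
        case Lb
        then show ?thesis using 1 by (simp add: pad_left_def)
      qed
      then show ?thesis by (rule prefix_imp_sublist)
    next
      case 2
      then show ?thesis using s_le by (rule sublist_order.order_trans[rotated])
    qed
  qed
qed

lemma sublist_padD:
  assumes "sublist (pad (singular (Suc n))) (pad w)" "w \<noteq> []"
  shows "sublist (singular (Suc n)) w"
proof -
  let ?s = "singular (Suc n)"
  have ne: "?s \<noteq> []" by (simp add: singular_Suc)
  have "sublist (rev (pad_left ?s)) (rev (pad_left w))"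
  proof (rule sublist_pad_leftD)
    show "sublist (pad_left (rev (pad_left ?s))) (pad_left (rev (pad_left w)))"
      using assms ne by (simp add: pad_eq_pad_left)
    show "rev (pad_left w) \<noteq> []" using assms(2) by (simp add: pad_left_def)
    assume "hd (rev (pad_left ?s)) = La"
    then have odd: "odd n"
      using ne by (auto simp: hd_rev pad_left_def last_singular split: if_splits)
    then obtain v where "?s = v @ [La, La]" using singular_ends[of n] by auto
    moreover have "pad_left ?s = ?s"
      using odd by (simp add: pad_left_def hd_singular)
    ultimately have "rev (pad_left ?s) = La # La # rev v" by simp
    then show "\<exists>u. rev (pad_left ?s) = La # La # u" by blast
  qed
  then have "sublist (pad_left ?s) (pad_left w)" by simp
  then show ?thesis
  proof (rule sublist_pad_leftD)
    assume "hd ?s = La"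
    then show "\<exists>u. ?s = La # La # u"
      using singular_ends[of n] by (auto split: if_splits)
  qed (rule assms(2))
qed

text \<open>If \<open>v = x s y\<close> with \<open>s\<close> singular, then \<open>\<sigma>(y)a\<close> starts with \<open>a\<close>, hence \<open>\<sigma>(v)a\<close> contains \<open>\<sigma>(s)a\<close>, which is
  the next singular word, padded.\<close>

lemma sublist_singular_step:
  assumes "sublist (singular n) v" "w \<noteq> []" "pad w = subst v @ [La]"
  shows "sublist (singular (Suc n)) w"
proof (rule sublist_padD)
  from assms(1) obtain x y where v: "v = x @ singular n @ y" by (auto simp: sublist_def)
  obtain r where "subst y @ [La] = La # r" using subst_snoc_La_Cons by blast
  then have "pad w = subst x @ pad (singular (Suc n)) @ r"
    by (simp add: assms(3) v subst_append pad_singular)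
  then show "sublist (pad (singular (Suc n))) (pad w)" by simp
qed (rule assms(2))

lemma singular_return_times: "\<exists>x. return_times n (singular n) x"
proof (induction n)
  case 0
  show ?case using return_times_La by (auto simp: singular_0)
next
  case (Suc n)
  then show ?case
    using return_times_step[OF _ _ pad_singular] by (auto simp: singular_Suc)
qed

lemma return_times_mono: "return_times n w x \<Longrightarrow> strict_mono x"
  unfolding strict_mono_Suc_iff return_times_def
  by (simp add: fib_neq_0_nat)

text \<open>Some two occurrences of \<open>w\<close> have distance \<open>fib (n + 2)\<close>, and each contains the singular word at the
  same offset. But any two occurrences of the latter have distance at least \<open>fib (m + 2)\<close>.\<close>

lemma singular_sublist_index:
  assumes x: "return_times n w x" and s: "sublist (singular m) w"
  shows "m \<le> n"
proof -
  obtain d where d: "\<And>i. i \<in> occs w \<Longrightarrow> i + d \<in> occs (singular m)"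
    using s by (rule occs_sublist) blast
  obtain y where y: "return_times m (singular m) y"
    using singular_return_times by blast
  \<comment> \<open>The shorter distance is taken after the letter \<open>b\<close>, which first occurs at position \<open>1\<close>.\<close>
  have "fib_letter 1 = Lb"
    using fib_letter_Suc_block_start[of 0] fib_letter_block_start[of 0] by simp
  then have x2: "x 2 = x 1 + fib (n + 2)"
    using x by (simp add: return_times_def numeral_2_eq_2)
  have "x 1 + d \<in> range y" "x 2 + d \<in> range y"
    using d x y by (metis rangeI return_times_def)+
  then obtain i j where i: "x 1 + d = y i" and j: "x 2 + d = y j" by blast
  have "0 < fib (n + 2)" by (rule fib_neq_0_nat) simp
  then have "y i < y j" using i j x2 by linarith
  then have "i < j" using return_times_mono[OF y] by (simp add: strict_mono_less)
  then have "y (Suc i) \<le> y j"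
    using return_times_mono[OF y] by (simp add: strict_mono_less_eq)
  moreover have "y i + fib (m + 2) \<le> y (Suc i)"
    using y fib_mono[of "m + 2" "m + 3"] by (simp add: return_times_def)
  ultimately have "fib (m + 2) \<le> fib (n + 2)" using i j x2 by linarith
  then show ?thesis using fib_less_mono[of "n + 2" "m + 2"] by (metis add_le_cancel_right le_add2 not_less)
qed

section \<open>Reduction of a factor to its kernel\<close>

text \<open>The words with \<open>n \<le> 1\<close> are listed because \<open>s\<^sub>-\<^sub>1\<close> and \<open>s\<^sub>0\<close> have the same length: a word with \<open>n = 1\<close> other
  than \<open>b\<close> contains both, and then the longest singular factor is not unique.\<close>

definition kernel_index :: "nat \<Rightarrow> word \<Rightarrow> bool" where
  "kernel_index n w \<longleftrightarrow> (\<exists>x. return_times n w x) \<and> sublist (singular n) w \<and>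
     (n = 0 \<longrightarrow> w = [La]) \<and> (n = 1 \<longrightarrow> w \<in> {[Lb], [La, Lb], [Lb, La], [La, Lb, La]})"

lemma kernel_index_La: "kernel_index 0 [La]"
  using return_times_La by (auto simp: kernel_index_def singular_0)

lemma pad_eq_aba:
  assumes "w \<noteq> []" "pad w = [La, Lb, La]"
  shows "w \<in> {[Lb], [La, Lb], [Lb, La], [La, Lb, La]}"
  using assms by (auto simp: pad_def Cons_eq_append_conv append_eq_Cons_conv split: if_splits)

lemma kernel_index_step:
  assumes "kernel_index n v" "w \<noteq> []" "pad w = subst v @ [La]"
  shows "kernel_index (Suc n) w"
  unfolding kernel_index_def
proof (intro conjI)
  show "\<exists>x. return_times (Suc n) w x"
    using assms return_times_step by (auto simp: kernel_index_def)
  show "sublist (singular (Suc n)) w"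
    using assms sublist_singular_step by (auto simp: kernel_index_def)
  show "Suc n = 1 \<longrightarrow> w \<in> {[Lb], [La, Lb], [Lb, La], [La, Lb, La]}"
  proof
    assume "Suc n = 1"
    then have "pad w = [La, Lb, La]" using assms by (simp add: kernel_index_def subst_Cons)
    with assms(2) show "w \<in> {[Lb], [La, Lb], [Lb, La], [La, Lb, La]}" by (rule pad_eq_aba)
  qed
qed simp

lemma segment_Nil_iff: "segment i j = [] \<longleftrightarrow> j \<le> i"
  by (auto simp: segment_def)

lemma hd_segment: "i < j \<Longrightarrow> hd (segment i j) = fib_letter i"
  by (simp add: segment_def hd_map)

lemma last_segment: "i < j \<Longrightarrow> last (segment i j) = fib_letter (j - 1)"
  by (simp add: segment_def last_map)

text \<open>The padded word starts at a block start and ends with the first letter of a block, hence it is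
  \<open>\<sigma>(v)a\<close>, where \<open>v\<close> collects the letters whose blocks lie in between. The bound \<open>q < j\<close> on the end
  of \<open>v\<close> makes the reduction terminate; the length does not serve, since \<open>b\<close> reduces to \<open>a\<close>.\<close>

lemma segment_desubst:
  assumes "i < j" "segment i j \<noteq> [La]"
  obtains p q where "p < q" "q < j" "pad (segment i j) = subst (segment p q) @ [La]"
proof -
  define i' where "i' = (if fib_letter i = Lb then i - 1 else i)"
  define j' where "j' = (if fib_letter (j - 1) = Lb then Suc j else j)"
  have i'_La: "fib_letter i' = La" and left: "i' \<le> i"
      "segment i' i = (if fib_letter i = Lb then [La] else [])"
    using La_before_Lb[of i] segment_Suc_eq[of "i - 1"]
    by (cases "fib_letter i"; simp add: i'_def segment_Nil_iff)+
  have j'_La: "fib_letter (j' - 1) = La" and right: "j \<le> j'"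
      "segment j j' = (if fib_letter (j - 1) = Lb then [La] else [])"
    using La_after_Lb[of "j - 1"] segment_Suc_eq[of j] \<open>i < j\<close>
    by (cases "fib_letter (j - 1)"; simp add: j'_def segment_Nil_iff)+
  have "pad (segment i j) = segment i' i @ segment i j @ segment j j'"
    using \<open>i < j\<close> by (simp add: pad_def left right hd_segment last_segment)
  also have "\<dots> = segment i' j'"
    using left(1) right(1) \<open>i < j\<close> by (simp add: segment_append)
  finally have pad: "pad (segment i j) = segment i' j'" .
  obtain p where p: "i' = block_start p" using i'_La by (auto simp: letter_La_iff)
  obtain q where q: "j' - 1 = block_start q" using j'_La by (auto simp: letter_La_iff)
  have j': "j' = Suc (block_start q)" using q right(1) \<open>i < j\<close> by simp
  have "block_start p \<le> block_start q"
    using left(1) right(1) \<open>i < j\<close> by (simp flip: p q)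
  then have "p \<le> q"
    using strict_mono_block_start by (simp add: strict_mono_less_eq)
  have pad': "pad (segment i j) = subst (segment p q) @ [La]"
    using \<open>p \<le> q\<close> strict_mono_block_start
    by (simp add: pad p j' segment_Suc subst_segment strict_mono_less_eq)
  have "p \<noteq> q"
  proof
    assume "p = q"
    then have "pad (segment i j) = [La]" using pad' by (simp add: segment_def)
    then show False using assms
      by (auto simp: pad_def Cons_eq_append_conv append_eq_Cons_conv segment_Nil_iff split: if_splits)
  qed
  with \<open>p \<le> q\<close> have "p < q" by simp
  \<comment> \<open>The first letter of \<open>F\<^sub>\<infinity>\<close> is \<open>a\<close>, so that \<open>block_start q > q\<close> for \<open>q > 0\<close>.\<close>
  have "0 < count_La q"
  proof -
    have "fib_letter 0 = La" using fib_letter_block_start[of 0] by simp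
    moreover have "count_La (Suc 0) \<le> count_La (Suc m)" for m by (induction m) auto
    ultimately have "0 < count_La (Suc m)" for m by (metis Suc_le_lessD One_nat_def add_0 count_La.simps)
    then show ?thesis using \<open>p < q\<close> by (cases q) auto
  qed
  moreover have "block_start q \<le> j" using j' by (auto simp: j'_def split: if_splits)
  ultimately have "q < j" by (simp add: block_start_def)
  with \<open>p < q\<close> pad' show thesis by (intro that)
qed

lemma segment_kernel_index: "i < j \<Longrightarrow> \<exists>n. kernel_index n (segment i j)"
proof (induction j arbitrary: i rule: less_induct)
  case (less j)
  show ?case
  proof (cases "segment i j = [La]")
    case True
    then show ?thesis using kernel_index_La by auto
  next
    case False
    with less.prems obtain p q
      where pq: "p < q" "q < j" and pad: "pad (segment i j) = subst (segment p q) @ [La]"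
      by (rule segment_desubst)
    from less.IH[OF pq(2) pq(1)] obtain n where "kernel_index n (segment p q)" ..
    then have "kernel_index (Suc n) (segment i j)"
      using pad less.prems by (intro kernel_index_step) (simp_all add: segment_Nil_iff)
    then show ?thesis ..
  qed
qed

lemma factor_kernel_index:
  assumes "w \<in> factors"
  obtains n where "kernel_index n w"
proof -
  from assms have "occ w \<noteq> {}" "w \<noteq> []" by (auto simp: factors_def)
  then obtain i where "i \<in> occs w" by (auto simp: occ_eq)
  then have "segment i (i + length w) = w" by (simp add: occs_iff_segment)
  then show thesis
    using segment_kernel_index[of i "i + length w"] \<open>w \<noteq> []\<close> that by auto
qed

section \<open>The singular kernel and the types\<close>

lemma singular_inj: "singular m = singular n \<Longrightarrow> m = n"
  using singular_return_times singular_sublist_index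
  by (metis le_antisym sublist_order.order_refl)

lemma sing_factors_eq: "sing_factors w = {singular m | m. sublist (singular m) w}"
proof -
  have "\<exists>m. sing k = singular m" if "k \<ge> -1" for k
    using that by (intro exI[of _ "nat (k + 1)"]) (simp add: singular_def)
  then show ?thesis by (fastforce simp: sing_factors_def singular_def)
qed

lemma sk_eq_singular:
  assumes w: "w \<in> factors" and n: "kernel_index n w"
  shows "sk w = singular n"
proof -
  have shorter: "length (singular m) < length (singular n)"
    if m: "sublist (singular m) w" "m \<noteq> n" for m
  proof -
    have "m \<le> n" using n m(1) singular_sublist_index by (auto simp: kernel_index_def)
    then have "m < n" using m(2) by simp
    show ?thesis
    proof (cases "n = 1")
      case True
      then have "w = [Lb]" using w n by (auto simp: kernel_index_def factors_def)
      moreover have "m = 0" using \<open>m < n\<close> True by simp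
      ultimately show ?thesis using m(1) by (simp add: singular_0 sublist_Cons_right)
    next
      case False
      show ?thesis
      proof (cases m)
        case 0
        then show ?thesis using fib_less_mono[of 2 "Suc n"] \<open>m < n\<close> False
          by (simp add: length_singular)
      next
        case (Suc k)
        then show ?thesis using fib_less_mono[of "Suc m" "Suc n"] \<open>m < n\<close>
          by (simp add: length_singular)
      qed
    qed
  qed
  have sub: "sublist (singular n) w" using n by (simp add: kernel_index_def)
  show ?thesis
    unfolding sk_def
  proof (rule the_equality)
    show "singular n \<in> sing_factors w \<and> (\<forall>u\<in>sing_factors w. length u \<le> length (singular n))"
      using sub shorter by (force simp: sing_factors_eq)
  next
    fix v
    assume v: "v \<in> sing_factors w \<and> (\<forall>u\<in>sing_factors w. length u \<le> length v)"
    then obtain m where m: "v = singular m" "sublist (singular m) w" by (auto simp: sing_factors_eq)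
    have "length (singular n) \<le> length v" using v sub by (auto simp: sing_factors_eq)
    then show "v = singular n" using m shorter by force
  qed
qed

lemma kernel_length: "kernel_index n w \<Longrightarrow> fib (n + 1) \<le> length w"
  using sublist_length_le[of "singular n" w] by (simp add: kernel_index_def length_singular)

text \<open>With kernel \<open>s\<^sub>n\<^sub>-\<^sub>1\<close>, type \<open>j\<close> means \<open>k = n + j - 2\<close>. For \<open>n = 0\<close> and \<open>j = 1\<close> no index \<open>k \<ge> 0\<close> exists, and the
  right-hand side fails too, as \<open>fib 2 = 1\<close> and \<open>w\<close> is nonempty.\<close>

lemma type_iff:
  assumes w: "w \<in> factors" and n: "kernel_index n w" and j: "j = 1 \<or> j = 2"
  shows "w \<in> T1 j \<union> T2 j \<longleftrightarrow> fib (n + j) \<le> length w \<and> length w < fib (n + j + 1)"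
proof -
  have sing: "sing (int n - 1) = sing (int k - int j + 1) \<longleftrightarrow> k + 2 = n + j" for k
  proof
    assume "sing (int n - 1) = sing (int k - int j + 1)"
    moreover have "int k - int j + 1 = int (k + 2 - j) - 1" using j by auto
    ultimately have "singular n = singular (k + 2 - j)" by (simp only: singular_def)
    from singular_inj[OF this] show "k + 2 = n + j" using j by auto
  next
    assume "k + 2 = n + j"
    then have "int n - 1 = int k - int j + 1" by linarith
    then show "sing (int n - 1) = sing (int k - int j + 1)" by (rule arg_cong)
  qed
  have "w \<in> T1 j \<union> T2 j \<longleftrightarrow> (\<exists>k. fib_len k \<le> length w \<and> length w < fib_len (k + 1) \<and>
      sk w = sing (int k - int j + 1))"
  proof -
    have "fib_len k < fib_len (k + 1)" for k
      unfolding fib_len_def by (intro fib_less_mono) simp_all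
    moreover have "w \<in> T1 j \<longleftrightarrow> (\<exists>k. length w = fib_len k \<and> sk w = sing (int k - int j + 1))"
      using w j by (auto simp: T1_def)
    moreover have "w \<in> T2 j \<longleftrightarrow> (\<exists>k. fib_len k < length w \<and> length w < fib_len (k + 1) \<and>
        sk w = sing (int k - int j + 1))"
      using w j by (auto simp: T2_def)
    ultimately show ?thesis
      unfolding Un_iff le_less by metis
  qed
  also have "\<dots> \<longleftrightarrow> (\<exists>k. fib_len k \<le> length w \<and> length w < fib_len (k + 1) \<and> k + 2 = n + j)"
    by (simp only: sk_eq_singular[OF w n] singular_def sing)
  also have "\<dots> \<longleftrightarrow> fib (n + j) \<le> length w \<and> length w < fib (n + j + 1)"
  proof (cases "n + j \<ge> 2")
    case True
    then obtain k where "n + j = k + 2" by (metis add.commute le_Suc_ex)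
    then show ?thesis by (auto simp: fib_len_def)
  next
    case False
    then have "n + j = 1" using j by auto
    moreover have "w \<noteq> []" using w by (simp add: factors_def)
    ultimately show ?thesis by (auto simp: numeral_2_eq_2)
  qed
  finally show ?thesis .
qed

section \<open>The separated property\<close>

lemma enumerate_range_strict_mono:
  fixes f :: "nat \<Rightarrow> nat"
  assumes "strict_mono f"
  shows "enumerate (range f) n = f n"
proof (induction n)
  case 0
  show ?case
    unfolding enumerate_0 by (rule Least_equality) (auto simp: strict_mono_less_eq[OF assms])
next
  case (Suc n)
  have "infinite (range f)"
    using assms by (simp add: range_inj_infinite strict_mono_imp_inj_on)
  then have "enumerate (range f) (Suc n) = (LEAST s. s \<in> range f \<and> f n < s)"
    by (simp add: enumerate_Suc'' Suc del: enumerate_Suc)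
  also have "\<dots> = f (Suc n)"
    by (rule Least_equality) (auto simp: strict_mono_less[OF assms] strict_mono_less_eq[OF assms])
  finally show ?case .
qed

lemma occ_pos_gap:
  assumes n: "kernel_index n w" and p: "p \<ge> 1"
  shows "occ_pos w (p + 1) = occ_pos w p + (if fib_inf p = La then fib (n + 3) else fib (n + 2))"
proof -
  obtain x where x: "return_times n w x" using n by (auto simp: kernel_index_def)
  from p obtain q where q: "p = Suc q" by (cases p) auto
  have mono: "strict_mono (\<lambda>i. Suc (x i))"
    using return_times_mono[OF x] by (simp add: strict_mono_def)
  have "occ w = range (\<lambda>i. Suc (x i))"
    using x by (auto simp: occ_eq return_times_def)
  then have "occ_pos w (Suc i) = Suc (x i)" for i
    by (simp add: occ_pos_def enumerate_range_strict_mono[OF mono])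
  then show ?thesis using x by (simp add: q return_times_def fib_letter_def)
qed

lemma sep_iff:
  assumes n: "kernel_index n w" and p: "p \<ge> 1"
  shows "sep i w p \<longleftrightarrow> (\<forall>t < i. length w < (if fib_inf (p + t) = La then fib (n + 3) else fib (n + 2)))"
  using occ_pos_gap[OF n, of "p + t" for t] p by (simp add: sep_def)

text \<open>The two possible distances \<open>fib (n + 2) \<le> fib (n + 3)\<close> are exactly the upper bounds for the
  lengths of the types \<open>1\<close> and \<open>2\<close>.\<close>

lemma spectrum_eq:
  assumes "i \<ge> 1"
  shows "spectrum i = (T1 1 \<union> T2 1) \<times> {1..}
    \<union> (T1 2 \<union> T2 2) \<times> {p. p \<ge> 1 \<and> (\<forall>t < i. fib_inf (p + t) = La)}" (is "_ = ?R")
proof -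
  have "(w, p) \<in> spectrum i \<longleftrightarrow> (w, p) \<in> ?R" if w: "w \<in> factors" for w p
  proof -
    obtain n where n: "kernel_index n w" using w by (rule factor_kernel_index)
    have le: "fib (n + 2) \<le> fib (n + 3)" by (rule fib_mono) simp
    have "sep i w p \<longleftrightarrow> length w < fib (n + 2) \<or>
        fib (n + 2) \<le> length w \<and> length w < fib (n + 3) \<and> (\<forall>t < i. fib_inf (p + t) = La)"
      if "p \<ge> 1"
    proof -
      have short: "length w < (if c = La then fib (n + 3) else fib (n + 2)) \<longleftrightarrow>
          length w < fib (n + 2) \<or> length w < fib (n + 3) \<and> c = La" for c
        using le by auto
      show ?thesis
        unfolding sep_iff[OF n that] short using assms le
        by (metis not_less le_less_trans less_le_trans less_eq_Suc_le One_nat_def)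
    qed
    moreover have "w \<in> T1 1 \<union> T2 1 \<longleftrightarrow> length w < fib (n + 2)"
      using type_iff[OF w n, of 1] kernel_length[OF n] by (simp add: numeral_2_eq_2)
    moreover have "w \<in> T1 2 \<union> T2 2 \<longleftrightarrow> fib (n + 2) \<le> length w \<and> length w < fib (n + 3)"
      using type_iff[OF w n, of 2] by (simp add: numeral_3_eq_3 numeral_2_eq_2)
    ultimately show ?thesis
      using w unfolding spectrum_def by blast
  qed
  moreover have "w \<in> factors" if "(w, p) \<in> spectrum i \<union> ?R" for w p
    using that by (auto simp: spectrum_def T1_def T2_def)
  ultimately have "x \<in> spectrum i \<longleftrightarrow> x \<in> ?R" for x
    by (cases x) blast
  then show ?thesis by blast
qed

text \<open>A Fibonacci number does not lie strictly between two consecutive ones.\<close>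

lemma T1_T2_disjnt:
  assumes "j = 1 \<or> j = 2"
  shows "disjnt (T1 j) (T2 j)"
proof -
  have False if w: "w \<in> T1 j" "w \<in> T2 j" for w
  proof -
    obtain k where k: "length w = fib_len k" using w by (auto simp: T1_def)
    obtain l where l: "fib_len l < length w" "length w < fib_len (l + 1)" using w by (auto simp: T2_def)
    show False using k l fib_mono[of "l + 3" "k + 2"] fib_mono[of "k + 2" "l + 2"]
      by (cases "k \<le> l") (auto simp: fib_len_def numeral_eq_Suc)
  qed
  then show ?thesis by (auto simp: disjnt_def)
qed

lemma types_disjnt: "disjnt (T1 1 \<union> T2 1) (T1 2 \<union> T2 2)"
proof -
  have "w \<notin> T1 2 \<union> T2 2" if "w \<in> T1 1 \<union> T2 1" for w
  proof -
    have w: "w \<in> factors" using that by (auto simp: T1_def T2_def)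
    then obtain n where n: "kernel_index n w" by (rule factor_kernel_index)
    show ?thesis using that type_iff[OF w n, of 1] type_iff[OF w n, of 2]
      by (auto simp: numeral_eq_Suc)
  qed
  then show ?thesis by (auto simp: disjnt_def)
qed

theorem proposition6p6:
  shows
    "spectrum 1 = (T1 1 \<union> T2 1) \<times> {1..} \<union> (T1 2 \<union> T2 2) \<times> Gamma_a \<and>
     spectrum 2 = (T1 1 \<union> T2 1) \<times> {1..} \<union> (T1 2 \<union> T2 2) \<times> Gamma_aa \<and>
     spectrum 3 = (T1 1 \<union> T2 1) \<times> {1..} \<and>
     {w \<in> factors. sep_inf w} = T1 1 \<union> T2 1 \<and>
     disjnt (T1 1) (T2 1) \<and> disjnt (T1 2) (T2 2) \<and>
     disjnt ((T1 1 \<union> T2 1) \<times> {1..}) ((T1 2 \<union> T2 2) \<times> Gamma_a) \<and>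
     disjnt ((T1 1 \<union> T2 1) \<times> {1..}) ((T1 2 \<union> T2 2) \<times> Gamma_aa)"
proof (intro conjI)
  show "spectrum 1 = (T1 1 \<union> T2 1) \<times> {1..} \<union> (T1 2 \<union> T2 2) \<times> Gamma_a"
    by (simp add: spectrum_eq Gamma_a_def)
  show "spectrum 2 = (T1 1 \<union> T2 1) \<times> {1..} \<union> (T1 2 \<union> T2 2) \<times> Gamma_aa"
    by (auto simp: spectrum_eq Gamma_aa_def less_2_cases_iff)
  have "\<not> (\<forall>t < 3. fib_inf (p + t) = La)" if "p \<ge> 1" for p
  proof
    assume *: "\<forall>t < 3. fib_inf (p + t) = La"
    from that obtain m where "p = Suc m" by (cases p) auto
    then show False
      using *[rule_format, of 0] *[rule_format, of 1] *[rule_format, of 2] no_three_La[of m]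
      by (simp add: fib_letter_def)
  qed
  then have "{p. p \<ge> 1 \<and> (\<forall>t < 3. fib_inf (p + t) = La)} = {}" by blast
  then show spec3: "spectrum 3 = (T1 1 \<union> T2 1) \<times> {1..}"
    by (simp only: spectrum_eq[OF one_le_numeral] Sigma_empty2 Un_empty_right)
  show "{w \<in> factors. sep_inf w} = T1 1 \<union> T2 1"
  proof (intro equalityI subsetI)
    fix w
    assume "w \<in> {w \<in> factors. sep_inf w}"
    then have w: "w \<in> factors" "sep_word 3 w" by (auto simp: sep_inf_def)
    then obtain p where "p \<ge> 1" "sep 3 w p" by (auto simp: sep_word_def)
    with w have "(w, p) \<in> spectrum 3" by (simp add: spectrum_def)
    then show "w \<in> T1 1 \<union> T2 1" by (simp add: spec3)
  next
    fix w
    assume w: "w \<in> T1 1 \<union> T2 1"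
    then have "(w, 1) \<in> spectrum i" if "i \<ge> 1" for i
      using spectrum_eq[OF that] by simp
    then have "sep i w 1" if "i \<ge> 1" for i
      using that by (auto simp: spectrum_def)
    moreover have "w \<in> factors" using w by (auto simp: T1_def T2_def)
    ultimately show "w \<in> {w \<in> factors. sep_inf w}"
      by (auto simp: sep_inf_def sep_word_def)
  qed
  show "disjnt (T1 1) (T2 1)" "disjnt (T1 2) (T2 2)" by (simp_all add: T1_T2_disjnt)
  show "disjnt ((T1 1 \<union> T2 1) \<times> {1..}) ((T1 2 \<union> T2 2) \<times> Gamma_a)"
    "disjnt ((T1 1 \<union> T2 1) \<times> {1..}) ((T1 2 \<union> T2 2) \<times> Gamma_aa)"
    using types_disjnt by (auto simp: disjnt_def)
qed

end
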